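(* Let $(X,M,* )$ be a fuzzy metric space. Then the following conditions are equivalent: (a) $(X,M,* )$ is weak $G$-complete. (b) Each real-valued continuous function on $(X,\tau_M)$ carries every $G$-Cauchy sequence of $(X,M,* )$ to a cofinally Cauchy sequence of $\mathbb R$ (endowed with the usual metric). (c) Each real-valued continuous function on $(X,\tau_M)$ carries every $G$-Cauchy sequence of $(X,M,* )$ to a pseudo-Cauchy sequence of $\mathbb R$ (endowed with the usual metric).
   Context: A continuous $t$-norm is a continuous, associative, commutative binary operation $*$ on $[0,1]$ with $a*1=a$ for all $a$, and $a*b\le c*d$ whenever $a\le c$, $b\le d$. A fuzzy metric space (George–Veeramani) is a triple $(X,M,* )$ where $X$ is a nonempty set, $*$ is a continuous $t$-norm and $M:X\times X\times(0,\infty)\to[0,1]$ satisfies, for all $x,y,z\in X$ and $s,t>0$: $M(x,y,t)>0$; $M(x,y,t)=1\iff x=y$; $M(x,y,t)=M(y,x,t)$; $M(x,y,t)*M(y,z,s)\le M(x,z,t+s)$; $M(x,y,\cdot):(0,\infty)\to[0,1]$ is continuous. The topology $\tau_M$ on $X$ is the one with base $\{B(x,r,t):x\in X,\ r\in(0,1),\ t>0\}$, where $B(x,r,t)=\{y\in X:M(x,y,t)>1-r\}$. A sequence converges (resp. clusters, i.e. has a cluster point) in $(X,M,* )$ if it does so in $(X,\tau_M)$. A sequence $(x_n)$ in $(X,M,* )$ is $G$-Cauchy if $\lim_{n\to\infty}M(x_n,x_{n+1},t)=1$ for all $t>0$. A fuzzy metric space is weak $G$-complete if every $G$-Cauchy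 sequence in it clusters. A sequence $(x_n)$ in a metric space $(Y,d)$ is cofinally Cauchy if for every $\epsilon>0$ there is an infinite subset $\mathbb N_\epsilon$ of $\mathbb N$ such that $d(x_p,x_q)<\epsilon$ for all $p,q\in\mathbb N_\epsilon$. It is pseudo-Cauchy if for every $\epsilon\in(0,1)$ and $k\in\mathbb N$ there exist $p,q\in\mathbb N$ with $p,q>k$, $p\ne q$ and $d(x_p,x_q)<\epsilon$. *)

theory Defs
  imports "HOL-Analysis.Analysis"
begin

text \<open>Functions of HOL are total, so all axioms are relativised: the \<open>t\<close>-norm to the unit
  interval, and \<open>M\<close> to points of the carrier \<open>X\<close> and positive parameters. Values of
  \<open>T\<close> and \<open>M\<close> elsewhere are irrelevant.\<close>

locale continuous_t_norm =
  fixes T :: "real \<Rightarrow> real \<Rightarrow> real"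
  assumes t_norm_closed: "\<lbrakk>a \<in> {0..1}; b \<in> {0..1}\<rbrakk> \<Longrightarrow> T a b \<in> {0..1}"
    and t_norm_assoc: "\<lbrakk>a \<in> {0..1}; b \<in> {0..1}; c \<in> {0..1}\<rbrakk> \<Longrightarrow> T (T a b) c = T a (T b c)"
    and t_norm_commute: "\<lbrakk>a \<in> {0..1}; b \<in> {0..1}\<rbrakk> \<Longrightarrow> T a b = T b a"
    and t_norm_one: "a \<in> {0..1} \<Longrightarrow> T a 1 = a"
    and t_norm_mono: "\<lbrakk>a \<in> {0..1}; b \<in> {0..1}; c \<in> {0..1}; d \<in> {0..1}; a \<le> c; b \<le> d\<rbrakk>
                      \<Longrightarrow> T a b \<le> T c d"
    and t_norm_continuous: "continuous_on ({0..1} \<times> {0..1}) (\<lambda>(a, b). T a b)"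

locale fuzzy_metric_space = continuous_t_norm T
  for X :: "'a set" and M :: "'a \<Rightarrow> 'a \<Rightarrow> real \<Rightarrow> real" and T :: "real \<Rightarrow> real \<Rightarrow> real" +
  assumes nonempty: "X \<noteq> {}"
    and M_range: "\<lbrakk>x \<in> X; y \<in> X; t > 0\<rbrakk> \<Longrightarrow> M x y t \<in> {0..1}"
    and M_pos: "\<lbrakk>x \<in> X; y \<in> X; t > 0\<rbrakk> \<Longrightarrow> M x y t > 0"
    and M_eq_1_iff: "\<lbrakk>x \<in> X; y \<in> X; t > 0\<rbrakk> \<Longrightarrow> M x y t = 1 \<longleftrightarrow> x = y"
    and M_sym: "\<lbrakk>x \<in> X; y \<in> X; t > 0\<rbrakk> \<Longrightarrow> M x y t = M y x t"
    and M_triangle: "\<lbrakk>x \<in> X; y \<in> X; z \<in> X; t > 0; s > 0\<rbrakk>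
                     \<Longrightarrow> T (M x y t) (M y z s) \<le> M x z (t + s)"
    and M_continuous: "\<lbrakk>x \<in> X; y \<in> X\<rbrakk> \<Longrightarrow> continuous_on {0<..} (M x y)"

definition fuzzy_ball :: "'a set \<Rightarrow> ('a \<Rightarrow> 'a \<Rightarrow> real \<Rightarrow> real) \<Rightarrow> 'a \<Rightarrow> real \<Rightarrow> real \<Rightarrow> 'a set" where
  "fuzzy_ball X M x r t = {y \<in> X. M x y t > 1 - r}"

definition fuzzy_balls :: "'a set \<Rightarrow> ('a \<Rightarrow> 'a \<Rightarrow> real \<Rightarrow> real) \<Rightarrow> 'a set set" where
  "fuzzy_balls X M = {fuzzy_ball X M x r t | x r t. x \<in> X \<and> 0 < r \<and> r < 1 \<and> t > 0}"

text \<open>The definition below is meaningful only because the balls really form a base in a fuzzy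
  metric space; see \<open>openin_fuzzy_topology\<close>.\<close>

definition fuzzy_topology :: "'a set \<Rightarrow> ('a \<Rightarrow> 'a \<Rightarrow> real \<Rightarrow> real) \<Rightarrow> 'a topology" where
  "fuzzy_topology X M = topology (arbitrary union_of (\<lambda>B. B \<in> fuzzy_balls X M))"

definition cluster_point :: "'a topology \<Rightarrow> (nat \<Rightarrow> 'a) \<Rightarrow> 'a \<Rightarrow> bool" where
  "cluster_point \<T> s l \<longleftrightarrow>
     l \<in> topspace \<T> \<and> (\<forall>U. openin \<T> U \<and> l \<in> U \<longrightarrow> (\<exists>\<^sub>F n in sequentially. s n \<in> U))"

definition G_Cauchy :: "'a set \<Rightarrow> ('a \<Rightarrow> 'a \<Rightarrow> real \<Rightarrow> real) \<Rightarrow> (nat \<Rightarrow> 'a) \<Rightarrow> bool" where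
  "G_Cauchy X M s \<longleftrightarrow> range s \<subseteq> X \<and> (\<forall>t>0. (\<lambda>n. M (s n) (s (Suc n)) t) \<longlonglongrightarrow> 1)"

definition weak_G_complete :: "'a set \<Rightarrow> ('a \<Rightarrow> 'a \<Rightarrow> real \<Rightarrow> real) \<Rightarrow> bool" where
  "weak_G_complete X M \<longleftrightarrow>
     (\<forall>s. G_Cauchy X M s \<longrightarrow> (\<exists>l. cluster_point (fuzzy_topology X M) s l))"

definition cofinally_Cauchy :: "(nat \<Rightarrow> 'b::metric_space) \<Rightarrow> bool" where
  "cofinally_Cauchy s \<longleftrightarrow>
     (\<forall>\<epsilon>>0. \<exists>N. infinite N \<and> (\<forall>p\<in>N. \<forall>q\<in>N. dist (s p) (s q) < \<epsilon>))"

definition pseudo_Cauchy :: "(nat \<Rightarrow> 'b::metric_space) \<Rightarrow> bool" where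
  "pseudo_Cauchy s \<longleftrightarrow>
     (\<forall>\<epsilon>\<in>{0<..<1}. \<forall>k. \<exists>p q. p > k \<and> q > k \<and> p \<noteq> q \<and> dist (s p) (s q) < \<epsilon>)"

context fuzzy_metric_space
begin

lemma M_mono:
  assumes "x \<in> X" "y \<in> X" "0 < s" "s \<le> t"
  shows "M x y s \<le> M x y t"
proof (cases "s = t")
  case False
  then have "T (M x y s) (M y y (t - s)) \<le> M x y (s + (t - s))"
    using assms by (intro M_triangle) auto
  moreover have "M y y (t - s) = 1" using assms False M_eq_1_iff[of y y "t - s"] by simp
  ultimately show ?thesis using assms M_range t_norm_one by simp
qed simp

lemma fuzzy_ball_mono:
  assumes "x \<in> X" "r \<le> r'" "0 < t" "t \<le> t'"
  shows "fuzzy_ball X M x r t \<subseteq> fuzzy_ball X M x r' t'"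
  using M_mono[OF assms(1) _ assms(3,4)] assms(2) by (fastforce simp: fuzzy_ball_def)

lemma centre_in_fuzzy_ball:
  assumes "x \<in> X" "0 < r" "0 < t"
  shows "x \<in> fuzzy_ball X M x r t"
  using assms M_eq_1_iff[of x x t] by (simp add: fuzzy_ball_def)

lemma fuzzy_ball_nhd:
  assumes x: "x \<in> X" and t: "t > 0" and z: "z \<in> fuzzy_ball X M x r t"
  obtains e s where "0 < e" "e < 1" "s > 0" "fuzzy_ball X M z e s \<subseteq> fuzzy_ball X M x r t"
proof -
  have zX: "z \<in> X" and Mz: "M x z t > 1 - r" using z by (auto simp: fuzzy_ball_def)
  have "isCont (M x z) t"
    using M_continuous[OF x zX] t by (simp add: continuous_on_eq_continuous_at)
  then have "(M x z \<longlongrightarrow> M x z t) (at_left t)"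
    unfolding isCont_def by (rule filterlim_mono) (auto simp: at_le)
  then have "eventually (\<lambda>u. M x z u > 1 - r) (at_left t)"
    using Mz by (rule order_tendstoD(1))
  moreover have "eventually (\<lambda>u. u > 0) (at_left t)"
    using eventually_at_left_real[OF t] by eventually_elim auto
  moreover have "eventually (\<lambda>u. u < t) (at_left t)"
    by (simp add: eventually_at_filter)
  ultimately have "eventually (\<lambda>u. M x z u > 1 - r \<and> u > 0 \<and> u < t) (at_left t)"
    by eventually_elim auto
  then obtain u where u: "M x z u > 1 - r" "u > 0" "u < t"
    using eventually_happens[of _ "at_left t"] by (auto simp: trivial_limit_at_left_real)
  define m where "m = M x z u"
  have m: "m \<in> {0..1}" "m > 1 - r" using u M_range[OF x zX] by (auto simp: m_def)
  have "continuous_on {0..1} (\<lambda>b. (\<lambda>(a, b). T a b) (m, b))"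
    by (rule continuous_on_compose2[OF t_norm_continuous]) (use m in \<open>auto intro!: continuous_intros\<close>)
  then have "((\<lambda>b. T m b) \<longlongrightarrow> T m 1) (at 1 within {0..1})"
    by (simp add: continuous_on_def)
  then have "eventually (\<lambda>b. T m b > 1 - r) (at 1 within {0..1})"
    using m t_norm_one by (intro order_tendstoD(1)) auto
  then obtain d where d: "d > 0" "\<And>b. \<lbrakk>b \<in> {0..1}; b \<noteq> 1; dist b 1 < d\<rbrakk> \<Longrightarrow> T m b > 1 - r"
    unfolding eventually_at by blast
  define e where "e = min (d/2) (1/2)"
  have e: "0 < e" "e < 1" "e < d" using d by (auto simp: e_def)
  have Te: "T m (1 - e) > 1 - r"
    using e by (intro d(2)) (auto simp: dist_real_def)
  have "fuzzy_ball X M z e (t - u) \<subseteq> fuzzy_ball X M x r t"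
  proof
    fix y assume "y \<in> fuzzy_ball X M z e (t - u)"
    then have y: "y \<in> X" "M z y (t - u) > 1 - e" by (auto simp: fuzzy_ball_def)
    have "1 - r < T m (1 - e)" by (rule Te)
    also have "\<dots> \<le> T m (M z y (t - u))"
      using m e y u M_range[OF zX y(1), of "t - u"] by (intro t_norm_mono) auto
    also have "\<dots> \<le> M x y (u + (t - u))"
      unfolding m_def using x zX y u by (intro M_triangle) auto
    finally show "y \<in> fuzzy_ball X M x r t" using y by (simp add: fuzzy_ball_def)
  qed
  then show ?thesis using e u by (intro that[of e "t - u"]) auto
qed

lemma istopology_fuzzy_balls: "istopology (arbitrary union_of (\<lambda>B. B \<in> fuzzy_balls X M))"
  unfolding istopology_base_eq
proof clarify
  fix A B assume A: "A \<in> fuzzy_balls X M" and B: "B \<in> fuzzy_balls X M"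
  obtain x r t where 1: "x \<in> X" "t > 0" "A = fuzzy_ball X M x r t"
    using A by (auto simp: fuzzy_balls_def)
  obtain x' r' t' where 2: "x' \<in> X" "t' > 0" "B = fuzzy_ball X M x' r' t'"
    using B by (auto simp: fuzzy_balls_def)
  show "(arbitrary union_of (\<lambda>B. B \<in> fuzzy_balls X M)) (A \<inter> B)"
    unfolding arbitrary_union_of_alt
  proof
    fix z assume z: "z \<in> A \<inter> B"
    then have zX: "z \<in> X" using 1 by (simp add: fuzzy_ball_def)
    obtain e s where 3: "0 < e" "e < 1" "s > 0" "fuzzy_ball X M z e s \<subseteq> A"
      using fuzzy_ball_nhd[of x t z r] 1 z by blast
    obtain e' s' where 4: "0 < e'" "e' < 1" "s' > 0" "fuzzy_ball X M z e' s' \<subseteq> B"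
      using fuzzy_ball_nhd[of x' t' z r'] 2 z by blast
    let ?e = "min e e'" and ?s = "min s s'"
    let ?C = "fuzzy_ball X M z ?e ?s"
    have es: "0 < ?e" "?e < 1" "?s > 0" using 3 4 by auto
    have "?C \<in> fuzzy_balls X M" unfolding fuzzy_balls_def using es zX by blast
    moreover have "z \<in> ?C" using centre_in_fuzzy_ball[OF zX es(1,3)] .
    moreover have "?C \<subseteq> fuzzy_ball X M z e s"
      by (rule fuzzy_ball_mono[OF zX _ es(3)]) auto
    moreover have "?C \<subseteq> fuzzy_ball X M z e' s'"
      by (rule fuzzy_ball_mono[OF zX _ es(3)]) auto
    ultimately show "\<exists>U. U \<in> fuzzy_balls X M \<and> z \<in> U \<and> U \<subseteq> A \<inter> B"
      using 3(4) 4(4) by (intro exI[of _ ?C] conjI Int_greatest) (assumption | erule (1) order_trans)+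
  qed
qed

lemma openin_fuzzy_topology:
  "openin (fuzzy_topology X M) = arbitrary union_of (\<lambda>B. B \<in> fuzzy_balls X M)"
  unfolding fuzzy_topology_def by (rule topology_inverse'[OF istopology_fuzzy_balls])

lemma topspace_fuzzy_topology: "topspace (fuzzy_topology X M) = X"
proof
  show "topspace (fuzzy_topology X M) \<subseteq> X"
  proof
    fix x assume "x \<in> topspace (fuzzy_topology X M)"
    then obtain U where "openin (fuzzy_topology X M) U" "x \<in> U"
      by (auto simp: topspace_def)
    then obtain B where "B \<in> fuzzy_balls X M" "x \<in> B"
      unfolding openin_fuzzy_topology arbitrary_union_of_alt by blast
    then show "x \<in> X" by (auto simp: fuzzy_balls_def fuzzy_ball_def)
  qed
  show "X \<subseteq> topspace (fuzzy_topology X M)"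
  proof
    fix x assume x: "x \<in> X"
    have *: "0 < (1/2::real)" "(1/2::real) < 1" "0 < (1::real)" by auto
    have "fuzzy_ball X M x (1/2) 1 \<in> fuzzy_balls X M"
      unfolding fuzzy_balls_def using x * by blast
    then have "openin (fuzzy_topology X M) (fuzzy_ball X M x (1/2) 1)"
      unfolding openin_fuzzy_topology by (rule arbitrary_union_of_inc)
    then show "x \<in> topspace (fuzzy_topology X M)"
      using centre_in_fuzzy_ball[OF x *(1,3)] openin_subset by (metis subsetD)
  qed
qed

end

end

theory Submission
  imports Defs
begin

text \<open>A cluster point \<open>l\<close> of \<open>s\<close> forces infinitely many values \<open>f (s n)\<close> of a continuous \<open>f\<close> to
  be close to \<open>f l\<close>, and in an infinite index set there are always two distinct indices beyond a
  given bound; so weak \<open>G\<close>-completeness gives the condition on cofinally Cauchy images, and this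
  gives the one on pseudo-Cauchy images.

  The substance is the way back. Let \<open>s\<close> be a \<open>G\<close>-Cauchy sequence without a cluster point.
  Equal terms at arbitrarily late distinct indices would make the image under every function
  pseudo-Cauchy, so repetitions have to be removed first. A value is attained only finitely often; hence one may jump from an index to the
  last index with the same value before taking the next step. This cuts the loops out of the
  sequence, and, because every remaining step is a step of \<open>s\<close>, the result is still \<open>G\<close>-Cauchy
  (\<open>G_Cauchy_inj_subsequence\<close>). Such an injective sequence runs through a closed discrete set, and
  there is a continuous \<open>f\<close> with \<open>f (s n) = n\<close> (\<open>continuous_map_counting_sequence\<close>), whose image
  sequence has gaps of length one.

  The function \<open>f\<close> is built from \<open>M\<close>: since \<open>M x y t\<close> is continuous in \<open>y\<close> (\<open>continuous_map_M\<close>),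
  cutting it off below with \<open>x = s n\<close> yields a bump function that vanishes outside a ball
  around \<open>s n\<close>. As the radii tend to zero and \<open>s\<close> has no cluster point, the
  triangle inequality makes these balls locally finite, and \<open>f\<close> is a locally finite sum of multiples of bumps.\<close>

section \<open>Cauchy conditions and cluster points\<close>

lemma cofinally_Cauchy_imp_pseudo_Cauchy:
  assumes "cofinally_Cauchy s"
  shows "pseudo_Cauchy s"
  unfolding pseudo_Cauchy_def
proof (intro ballI allI)
  fix e :: real and k :: nat assume "e \<in> {0<..<1}"
  then have "e > 0" by simp
  then obtain N where N: "infinite N" "\<forall>p\<in>N. \<forall>q\<in>N. dist (s p) (s q) < e"
    using assms unfolding cofinally_Cauchy_def by blast
  have unbounded: "\<exists>n>m. n \<in> N" for m using N(1) infinite_nat_iff_unbounded by blast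
  obtain p where p: "p \<in> N" "p > k" using unbounded by blast
  obtain q where q: "q \<in> N" "q > p" using unbounded by blast
  have "dist (s p) (s q) < e" "q > k" "p \<noteq> q" using N(2) p q by simp_all
  then show "\<exists>p q. p > k \<and> q > k \<and> p \<noteq> q \<and> dist (s p) (s q) < e"
    using p(2) by blast
qed

lemma cluster_point_imp_cofinally_Cauchy:
  fixes f :: "'a \<Rightarrow> 'b::metric_space"
  assumes f: "continuous_map \<T> euclidean f" and l: "cluster_point \<T> s l"
  shows "cofinally_Cauchy (f \<circ> s)"
  unfolding cofinally_Cauchy_def
proof (intro allI impI)
  fix e :: real assume e: "e > 0"
  define U where "U = {x \<in> topspace \<T>. f x \<in> ball (f l) (e/2)}"
  have "openin \<T> U"
    unfolding U_def by (rule openin_continuous_map_preimage[OF f]) simp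
  moreover have "l \<in> U" using l e by (simp add: U_def cluster_point_def)
  ultimately have "\<exists>\<^sub>F n in sequentially. s n \<in> U" using l by (auto simp: cluster_point_def)
  then have "infinite {n. s n \<in> U}" by (simp add: cofinite_eq_sequentially[symmetric] frequently_cofinite)
  moreover have "dist ((f \<circ> s) p) ((f \<circ> s) q) < e" if "s p \<in> U" "s q \<in> U" for p q
  proof -
    have "dist (f (s p)) (f l) < e/2" "dist (f (s q)) (f l) < e/2"
      using that by (auto simp: U_def dist_commute)
    then show ?thesis using dist_triangle_half_l[of "f (s p)" "f l" e "f (s q)"] by simp
  qed
  ultimately show "\<exists>N. infinite N \<and> (\<forall>p\<in>N. \<forall>q\<in>N. dist ((f \<circ> s) p) ((f \<circ> s) q) < e)"
    by (intro exI[of _ "{n. s n \<in> U}"]) auto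
qed

lemma no_cluster_point_subseq:
  assumes "\<nexists>l. cluster_point \<T> s l" "strict_mono h"
  shows "\<nexists>l. cluster_point \<T> (s \<circ> h) l"
proof
  assume "\<exists>l. cluster_point \<T> (s \<circ> h) l"
  then obtain l where l: "cluster_point \<T> (s \<circ> h) l" ..
  have "cluster_point \<T> s l"
    unfolding cluster_point_def
  proof (intro conjI allI impI)
    show "l \<in> topspace \<T>" using l by (simp add: cluster_point_def)
    fix U assume "openin \<T> U \<and> l \<in> U"
    then have "\<exists>\<^sub>F n in sequentially. s (h n) \<in> U" using l by (simp add: cluster_point_def)
    then show "\<exists>\<^sub>F n in sequentially. s n \<in> U"
      unfolding frequently_def
      using eventually_subseq[OF assms(2), of "\<lambda>n. s n \<notin> U"] by auto
  qed
  then show False using assms(1) by blast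
qed

lemma no_cluster_point_finite_fibre:
  assumes "\<nexists>l. cluster_point \<T> s l" "x \<in> topspace \<T>"
  shows "finite {n. s n = x}"
proof (rule ccontr)
  assume "infinite {n. s n = x}"
  then have fr: "\<exists>\<^sub>F n in sequentially. s n = x"
    by (simp add: cofinite_eq_sequentially[symmetric] frequently_cofinite)
  have "cluster_point \<T> s x"
    unfolding cluster_point_def using assms(2) by (auto intro: frequently_elim1[OF fr])
  then show False using assms(1) by blast
qed

text \<open>Loops can be cut out of a sequence with finite fibres: after each step of \<open>s\<close> the next chosen
  index is the last one at which the value reached recurs. Consequently that value does not occur
  again, while consecutive values of the subsequence are consecutive values of \<open>s\<close>.\<close>

lemma loop_erased_subsequence:
  assumes fin: "\<And>n. finite {m. s m = s n}"
  obtains h :: "nat \<Rightarrow> nat" where "strict_mono h" "inj (s \<circ> h)" "\<And>k. s (h (Suc k)) = s (Suc (h k))"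
proof -
  define L where "L n = Max {m. s m = s n}" for n
  have L: "s (L n) = s n" for n
    using Max_in[OF fin[of n]] by (auto simp: L_def)
  have L_ge: "m \<le> L n" if "s m = s n" for m n
    unfolding L_def using fin that by (intro Max_ge) auto
  define h where "h = rec_nat (L 0) (\<lambda>_ n. L (Suc n))"
  have h0: "h 0 = L 0" and hS: "h (Suc k) = L (Suc (h k))" for k
    by (simp_all add: h_def)
  have mono: "strict_mono h"
    unfolding strict_mono_Suc_iff using L_ge[OF refl] hS by (metis Suc_le_eq)
  have last: "m \<le> h k" if "s m = s (h k)" for m k
    using that by (cases k) (auto simp: h0 hS L intro: L_ge)
  have "inj (s \<circ> h)"
  proof (rule injI)
    fix j k assume "(s \<circ> h) j = (s \<circ> h) k"
    then have "h j = h k" using last by (simp add: order.antisym)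
    then show "j = k" using mono by (simp add: strict_mono_eq)
  qed
  then show ?thesis using mono L hS by (intro that[of h]) auto
qed

context fuzzy_metric_space
begin

lemma G_Cauchy_inj_subsequence:
  assumes s: "G_Cauchy X M s" and nc: "\<nexists>l. cluster_point (fuzzy_topology X M) s l"
  obtains h where "strict_mono h" "inj (s \<circ> h)" "G_Cauchy X M (s \<circ> h)"
proof -
  have sX: "s n \<in> X" for n using s by (auto simp: G_Cauchy_def)
  have "finite {m. s m = s n}" for n
    using no_cluster_point_finite_fibre[OF nc] sX by (simp add: topspace_fuzzy_topology)
  then obtain h where h: "strict_mono h" "inj (s \<circ> h)" "\<And>k. s (h (Suc k)) = s (Suc (h k))"
    by (rule loop_erased_subsequence) blast
  have "(\<lambda>k. M (s (h k)) (s (h (Suc k))) t) \<longlonglongrightarrow> 1" if "t > 0" for t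
  proof -
    have "(\<lambda>n. M (s n) (s (Suc n)) t) \<longlonglongrightarrow> 1" using s that by (simp add: G_Cauchy_def)
    from LIMSEQ_subseq_LIMSEQ[OF this h(1)] show ?thesis by (simp add: o_def h(3))
  qed
  then have "G_Cauchy X M (s \<circ> h)" using sX by (auto simp: G_Cauchy_def)
  then show ?thesis using h that by blast
qed

section \<open>Balls and the continuity of the fuzzy metric\<close>

text \<open>Continuity of the \<open>t\<close>-norm at \<open>(a, 1)\<close>, where its value is \<open>a\<close>. This is what makes the
  triangle inequality useful: composing with a nearly perfect closeness costs arbitrarily little.\<close>

lemma t_norm_near_one:
  assumes a: "a \<in> {0..1}" and c: "c < a"
  obtains e where "0 < e" "e < 1" "T a (1 - e) > c"
proof -
  have "continuous_on {0..1} (\<lambda>b. (\<lambda>(a, b). T a b) (a, b))"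
    by (rule continuous_on_compose2[OF t_norm_continuous]) (use a in \<open>auto intro!: continuous_intros\<close>)
  then have "((\<lambda>b. T a b) \<longlongrightarrow> T a 1) (at 1 within {0..1})"
    by (simp add: continuous_on_def)
  then have "eventually (\<lambda>b. T a b > c) (at 1 within {0..1})"
    using a c t_norm_one by (intro order_tendstoD(1)) auto
  then obtain d where d: "d > 0" "\<And>b. \<lbrakk>b \<in> {0..1}; b \<noteq> 1; dist b 1 < d\<rbrakk> \<Longrightarrow> T a b > c"
    unfolding eventually_at by blast
  define e where "e = min (d/2) (1/2)"
  have e: "0 < e" "e < 1" "e < d" using d by (auto simp: e_def)
  have "T a (1 - e) > c" using e by (intro d(2)) (auto simp: dist_real_def)
  then show ?thesis using e that by blast
qed

lemma openin_fuzzy_iff: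
  "openin (fuzzy_topology X M) U \<longleftrightarrow> U \<subseteq> X \<and> (\<forall>x\<in>U. \<exists>e>0. fuzzy_ball X M x e e \<subseteq> U)"
proof (intro iffI conjI ballI)
  assume U: "openin (fuzzy_topology X M) U"
  show UX: "U \<subseteq> X" using openin_subset[OF U] by (simp add: topspace_fuzzy_topology)
  fix x assume x: "x \<in> U"
  obtain B where B: "B \<in> fuzzy_balls X M" "x \<in> B" "B \<subseteq> U"
    using U x unfolding openin_fuzzy_topology arbitrary_union_of_alt by blast
  obtain y r t where y: "y \<in> X" "t > 0" "B = fuzzy_ball X M y r t"
    using B(1) by (auto simp: fuzzy_balls_def)
  obtain e u where eu: "0 < e" "u > 0" "fuzzy_ball X M x e u \<subseteq> B"
    unfolding y(3) by (rule fuzzy_ball_nhd[OF y(1,2) B(2)[unfolded y(3)]])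
  have "fuzzy_ball X M x (min e u) (min e u) \<subseteq> fuzzy_ball X M x e u"
    using eu x UX by (intro fuzzy_ball_mono) auto
  then show "\<exists>e>0. fuzzy_ball X M x e e \<subseteq> U"
    using eu B(3) by (intro exI[of _ "min e u"]) auto
next
  assume "U \<subseteq> X \<and> (\<forall>x\<in>U. \<exists>e>0. fuzzy_ball X M x e e \<subseteq> U)"
  then have UX: "U \<subseteq> X" and U: "\<And>x. x \<in> U \<Longrightarrow> \<exists>e>0. fuzzy_ball X M x e e \<subseteq> U"
    by simp_all
  show "openin (fuzzy_topology X M) U"
    unfolding openin_fuzzy_topology arbitrary_union_of_alt
  proof
    fix x assume x: "x \<in> U"
    obtain e where e: "e > 0" "fuzzy_ball X M x e e \<subseteq> U" using U[OF x] by blast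
    (* The base only has balls with first radius below one. *)
    let ?B = "fuzzy_ball X M x (min e (1/2)) e"
    have xX: "x \<in> X" using UX x by (rule subsetD)
    have "0 < min e (1/2)" "min e (1/2) < 1" using e by auto
    then have "?B \<in> fuzzy_balls X M" "x \<in> ?B"
      unfolding fuzzy_balls_def using xX e(1) by (blast, intro centre_in_fuzzy_ball)
    moreover have "?B \<subseteq> U" using fuzzy_ball_mono[OF xX, of "min e (1/2)" e e e] e by auto
    ultimately show "\<exists>B. B \<in> fuzzy_balls X M \<and> x \<in> B \<and> B \<subseteq> U" by blast
  qed
qed

lemma openin_fuzzy_ball:
  assumes "x \<in> X" "t > 0"
  shows "openin (fuzzy_topology X M) (fuzzy_ball X M x r t)"
  unfolding openin_fuzzy_iff
proof (intro conjI ballI)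
  show "fuzzy_ball X M x r t \<subseteq> X" by (auto simp: fuzzy_ball_def)
  fix z assume z: "z \<in> fuzzy_ball X M x r t"
  then have zX: "z \<in> X" by (simp add: fuzzy_ball_def)
  obtain e u where eu: "0 < e" "u > 0" "fuzzy_ball X M z e u \<subseteq> fuzzy_ball X M x r t"
    by (rule fuzzy_ball_nhd[OF assms z])
  have "fuzzy_ball X M z (min e u) (min e u) \<subseteq> fuzzy_ball X M z e u"
    using eu zX by (intro fuzzy_ball_mono) auto
  then show "\<exists>e>0. fuzzy_ball X M z e e \<subseteq> fuzzy_ball X M x r t"
    using eu by (intro exI[of _ "min e u"]) auto
qed

text \<open>Superlevel sets of \<open>M x y t\<close> in \<open>y\<close> are balls, hence open. For a sublevel set, continuity in
  \<open>t\<close> leaves room to enlarge \<open>t\<close> a little; the triangle inequality, solved for \<open>M x y t\<close>, then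
  bounds it from above for all \<open>y\<close> near \<open>z\<close>.\<close>

lemma continuous_map_M:
  assumes x: "x \<in> X" and t: "t > 0"
  shows "continuous_map (fuzzy_topology X M) euclideanreal (\<lambda>y. M x y t)"
  unfolding continuous_map_upper_lower_semicontinuous_lt topspace_fuzzy_topology
proof (intro conjI allI)
  fix a
  have "{y \<in> X. M x y t > a} = fuzzy_ball X M x (1 - a) t" by (simp add: fuzzy_ball_def)
  then show "openin (fuzzy_topology X M) {y \<in> X. M x y t > a}"
    using openin_fuzzy_ball[OF x t] by simp
next
  fix a
  show "openin (fuzzy_topology X M) {y \<in> X. M x y t < a}"
    unfolding openin_fuzzy_iff
  proof (intro conjI ballI)
    fix z assume "z \<in> {y \<in> X. M x y t < a}"
    then have z: "z \<in> X" "M x z t < a" by auto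
    show "\<exists>e>0. fuzzy_ball X M z e e \<subseteq> {y \<in> X. M x y t < a}"
    proof (cases "a \<le> 1")
      case False
      then have "fuzzy_ball X M z 1 1 \<subseteq> {y \<in> X. M x y t < a}"
        using M_range[OF x _ t] by (fastforce simp: fuzzy_ball_def)
      then show ?thesis using zero_less_one by blast
    next
      case True
      have a: "a \<in> {0..1}" using True z M_pos[OF x z(1) t] by simp
      have "isCont (M x z) t"
        using M_continuous[OF x z(1)] t by (simp add: continuous_on_eq_continuous_at)
      then have "eventually (\<lambda>u. M x z u < a) (at_right t)"
        using order_tendstoD(2)[of "M x z" _ "at t"] z(2)
        by (auto simp: isCont_def intro: filter_leD[of "at_right t" "at t"] at_le)
      then obtain u0 where u0: "u0 > t" "\<And>u. \<lbrakk>t < u; u < u0\<rbrakk> \<Longrightarrow> M x z u < a"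
        unfolding eventually_at_right_field by blast
      define d where "d = (u0 - t) / 2"
      have d: "d > 0" "M x z (t + d) < a" using u0 by (auto simp: d_def field_simps)
      obtain e where e: "0 < e" "e < 1" "T a (1 - e) > M x z (t + d)"
        using t_norm_near_one[OF a d(2)] by blast
      have "fuzzy_ball X M z (min e d) (min e d) \<subseteq> fuzzy_ball X M z e d"
        using e d z by (intro fuzzy_ball_mono) auto
      also have "\<dots> \<subseteq> {y \<in> X. M x y t < a}"
      proof clarify
        fix y assume "y \<in> fuzzy_ball X M z e d"
        then have y: "y \<in> X" "M y z d > 1 - e" using M_sym[OF z(1)] d by (auto simp: fuzzy_ball_def)
        have "M x y t < a"
        proof (rule ccontr)
          assume "\<not> M x y t < a"
          then have "T a (1 - e) \<le> T (M x y t) (M y z d)"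
            using a e y d t M_range[OF x y(1) t] M_range[OF y(1) z(1) d(1)] by (intro t_norm_mono) auto
          also have "\<dots> \<le> M x z (t + d)" using x y z d t by (intro M_triangle) auto
          finally show False using e by simp
        qed
        then show "y \<in> X \<and> M x y t < a" using y by simp
      qed
      finally show ?thesis using e d by (intro exI[of _ "min e d"]) auto
    qed
  qed auto
qed

text \<open>The fuzzy counterpart of adding two small radii: the triangle inequality through a common point
  of the balls, with both closenesses so near one that their \<open>T\<close>-product still exceeds \<open>1 - r\<close>.
  It makes families of shrinking balls locally finite.\<close>

lemma fuzzy_balls_meet:
  assumes z: "z \<in> X" and r: "r > 0"
  obtains d where "d > 0"
    "\<And>x e. \<lbrakk>x \<in> X; 0 < e; e \<le> d; fuzzy_ball X M z d d \<inter> fuzzy_ball X M x e e \<noteq> {}\<rbrakk>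
      \<Longrightarrow> x \<in> fuzzy_ball X M z r r"
proof -
  define q where "q = min (r/2) (1/2)"
  have q: "0 < q" "q < 1" "q < r" using r by (auto simp: q_def)
  obtain c where c: "0 < c" "c < 1" "T (1 - q) (1 - c) > 1 - r"
    using t_norm_near_one[of "1 - q" "1 - r"] q by auto
  define d where "d = min (min q c) (r/2)"
  have d: "d > 0" "d \<le> q" "d \<le> c" "d \<le> r/2" using q c r by (auto simp: d_def)
  show ?thesis
  proof (rule that[OF d(1)])
    fix x e assume x: "x \<in> X" and e: "0 < e" "e \<le> d"
      and "fuzzy_ball X M z d d \<inter> fuzzy_ball X M x e e \<noteq> {}"
    then obtain y where y: "y \<in> X" "M z y d > 1 - d" "M y x e > 1 - e"
      using M_sym[OF x] by (auto simp: fuzzy_ball_def)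
    have "1 - r < T (1 - q) (1 - c)" by (rule c)
    also have "\<dots> \<le> T (M z y d) (M y x e)"
      using q c d e y M_range[OF z y(1) d(1)] M_range[OF y(1) x e(1)] by (intro t_norm_mono) auto
    also have "\<dots> \<le> M z x (d + e)" using z y x d e by (intro M_triangle) auto
    also have "\<dots> \<le> M z x r" using z x d e by (intro M_mono) auto
    finally show "x \<in> fuzzy_ball X M z r r" using x by (simp add: fuzzy_ball_def)
  qed
qed

section \<open>A continuous function counting a closed discrete sequence\<close>

lemma not_cluster_point_ball:
  assumes "l \<in> X" "\<not> cluster_point (fuzzy_topology X M) s l"
  obtains e where "e > 0" "\<forall>\<^sub>F n in sequentially. s n \<notin> fuzzy_ball X M l e e"
proof -
  obtain U where U: "openin (fuzzy_topology X M) U" "l \<in> U" "\<forall>\<^sub>F n in sequentially. s n \<notin> U"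
    using assms by (auto simp: cluster_point_def topspace_fuzzy_topology not_frequently)
  obtain e where "e > 0" "fuzzy_ball X M l e e \<subseteq> U" using U openin_fuzzy_iff by blast
  then show ?thesis using U(3) by (intro that[of e]) (auto elim: eventually_mono)
qed

lemma eventually_notin_fuzzy_ball:
  assumes x: "x \<in> X" and d: "d > 0" "y \<notin> fuzzy_ball X M x d d"
  shows "\<forall>\<^sub>F e in at_right 0. y \<notin> fuzzy_ball X M x e e"
  using eventually_at_right_real[OF d(1)]
proof eventually_elim
  case (elim e)
  then show ?case using fuzzy_ball_mono[OF x, of e d e d] d(2) by auto
qed

text \<open>Finitely many terms are excluded one at a time because points are separated, the remaining
  ones all at once because \<open>s n\<close> is not a cluster point.\<close>

lemma isolating_radius:
  assumes s: "range s \<subseteq> X" "inj s" and nc: "\<not> cluster_point (fuzzy_topology X M) s (s n)"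
  shows "\<forall>\<^sub>F e in at_right 0. \<forall>m. m \<noteq> n \<longrightarrow> s m \<notin> fuzzy_ball X M (s n) e e"
proof -
  have sX: "s k \<in> X" for k using s by auto
  obtain d where d: "d > 0" "\<forall>\<^sub>F m in sequentially. s m \<notin> fuzzy_ball X M (s n) d d"
    using not_cluster_point_ball[OF sX nc] by blast
  then obtain N where N: "\<And>m. m \<ge> N \<Longrightarrow> s m \<notin> fuzzy_ball X M (s n) d d"
    unfolding eventually_sequentially by blast
  have "\<forall>\<^sub>F e in at_right 0. s m \<notin> fuzzy_ball X M (s n) e e" if "m \<noteq> n" for m
  proof -
    have "s n \<noteq> s m" using that s(2) by (auto dest: injD)
    then have less: "M (s n) (s m) 1 < 1"
      using M_eq_1_iff[OF sX sX, of 1 n m] M_range[OF sX sX, of 1 n m] by fastforce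
    define c where "c = 1 - M (s n) (s m) 1"
    have c: "c > 0" "c \<le> 1" using less M_range[OF sX sX, of 1 n m] by (auto simp: c_def)
    have "M (s n) (s m) c \<le> 1 - c" using M_mono[OF sX sX c, of n m] by (simp add: c_def)
    then show ?thesis
      using c by (intro eventually_notin_fuzzy_ball[OF sX c(1)]) (simp add: fuzzy_ball_def)
  qed
  then have "\<forall>\<^sub>F e in at_right 0. \<forall>m \<in> {..<N} - {n}. s m \<notin> fuzzy_ball X M (s n) e e"
    by (intro eventually_ball_finite) auto
  then show ?thesis
    using eventually_at_right_real[OF d(1)]
  proof eventually_elim
    case (elim e)
    then have "fuzzy_ball X M (s n) e e \<subseteq> fuzzy_ball X M (s n) d d"
      by (intro fuzzy_ball_mono sX) auto
    then show ?case using N elim by (metis DiffI lessThan_iff not_le singletonD subsetD)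
  qed
qed

text \<open>The function is \<open>n\<close> times a bump at each \<open>s n\<close>. Each bump vanishes outside a ball that avoids the
  other terms of the sequence, which gives the values, and the radii tend to zero. A point \<open>z\<close>
  where these balls accumulated would by \<open>fuzzy_balls_meet\<close> be a cluster point of \<open>s\<close>; hence near
  every point the sum is finite, and continuity is local.\<close>

lemma continuous_map_counting_sequence:
  assumes s: "range s \<subseteq> X" "inj s" and nc: "\<nexists>l. cluster_point (fuzzy_topology X M) s l"
  obtains f where "continuous_map (fuzzy_topology X M) euclideanreal f" "\<And>n. f (s n) = real n"
proof -
  let ?\<T> = "fuzzy_topology X M"
  have sX: "s k \<in> X" for k using s by auto
  have "\<exists>e. 0 < e \<and> e < inverse (real (Suc n)) \<and> (\<forall>m. m \<noteq> n \<longrightarrow> s m \<notin> fuzzy_ball X M (s n) e e)"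
    for n
  proof -
    have "\<forall>\<^sub>F e in at_right 0. e \<in> {0<..<inverse (real (Suc n))}"
      by (rule eventually_at_right_real) simp
    moreover have "\<forall>\<^sub>F e in at_right 0. \<forall>m. m \<noteq> n \<longrightarrow> s m \<notin> fuzzy_ball X M (s n) e e"
      using isolating_radius[OF s] nc by blast
    ultimately have "\<forall>\<^sub>F e in at_right 0. 0 < e \<and> e < inverse (real (Suc n)) \<and>
        (\<forall>m. m \<noteq> n \<longrightarrow> s m \<notin> fuzzy_ball X M (s n) e e)"
      by eventually_elim auto
    then show ?thesis
      using eventually_happens'[OF trivial_limit_at_right_real] by blast
  qed
  then obtain e where e: "\<And>n. 0 < e n" "\<And>n. e n < inverse (real (Suc n))"
    "\<And>m n. m \<noteq> n \<Longrightarrow> s m \<notin> fuzzy_ball X M (s n) (e n) (e n)"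
    by metis
  define \<phi> where "\<phi> n y = max 0 ((M (s n) y (e n) - (1 - e n)) / e n)" for n y
  have cont: "continuous_map ?\<T> euclideanreal (\<phi> n)" for n
    unfolding \<phi>_def using e(1)[of n]
    by (intro continuous_intros continuous_map_real_max continuous_map_M sX) auto
  have outside: "\<phi> n y = 0" if "y \<in> X" "y \<notin> fuzzy_ball X M (s n) (e n) (e n)" for n y
    using that e(1)[of n] by (auto simp: \<phi>_def fuzzy_ball_def max_def divide_le_0_iff zero_le_divide_iff)
  have centre: "\<phi> n (s n) = 1" for n
    using e(1)[of n] M_eq_1_iff[OF sX sX e(1), of n n n] by (simp add: \<phi>_def)
  (* The default value of the sum over an infinite set never enters: every point has a
     neighbourhood on which only finitely many summands are nonzero. *)
  define f where "f y = (\<Sum>n | \<phi> n y \<noteq> 0. real n * \<phi> n y)" for y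
  have local: "\<exists>W N. openin ?\<T> W \<and> z \<in> W \<and> (\<forall>y\<in>W. f y = (\<Sum>n<N. real n * \<phi> n y))" if z: "z \<in> X" for z
  proof -
    obtain r where r: "r > 0" "\<forall>\<^sub>F n in sequentially. s n \<notin> fuzzy_ball X M z r r"
      using not_cluster_point_ball[OF z] nc by blast
    obtain d where d: "d > 0"
      "\<And>x e. \<lbrakk>x \<in> X; 0 < e; e \<le> d; fuzzy_ball X M z d d \<inter> fuzzy_ball X M x e e \<noteq> {}\<rbrakk>
        \<Longrightarrow> x \<in> fuzzy_ball X M z r r"
      using fuzzy_balls_meet[OF z r(1)] by blast
    have "\<forall>\<^sub>F n in sequentially. inverse (real (Suc n)) < d"
      using LIMSEQ_inverse_real_of_nat d(1) by (rule order_tendstoD(2))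
    then have "\<forall>\<^sub>F n in sequentially. fuzzy_ball X M z d d \<inter> fuzzy_ball X M (s n) (e n) (e n) = {}"
      using r(2)
    proof eventually_elim
      case (elim n)
      then show ?case using d(2)[OF sX e(1), of n n] e(2)[of n] by fastforce
    qed
    then obtain N where N: "\<And>n. n \<ge> N \<Longrightarrow>
        fuzzy_ball X M z d d \<inter> fuzzy_ball X M (s n) (e n) (e n) = {}"
      unfolding eventually_sequentially by blast
    have "f y = (\<Sum>n<N. real n * \<phi> n y)" if y: "y \<in> fuzzy_ball X M z d d" for y
      unfolding f_def
    proof (rule sum.mono_neutral_left)
      have "y \<in> X" using y by (simp add: fuzzy_ball_def)
      then show "{n. \<phi> n y \<noteq> 0} \<subseteq> {..<N}" using outside N y by (fastforce simp: not_less[symmetric])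
    qed auto
    then show ?thesis
      using openin_fuzzy_ball[OF z d(1)] centre_in_fuzzy_ball[OF z d(1) d(1)] by blast
  qed
  then obtain W N where W: "\<And>z. z \<in> X \<Longrightarrow> openin ?\<T> (W z)" "\<And>z. z \<in> X \<Longrightarrow> z \<in> W z"
    "\<And>z y. \<lbrakk>z \<in> X; y \<in> W z\<rbrakk> \<Longrightarrow> f y = (\<Sum>n<N z. real n * \<phi> n y)"
    by metis
  have "continuous_map ?\<T> euclideanreal f"
  proof (rule pasting_lemma[where I = X and T = W and f = "\<lambda>_. f"])
    fix z assume z: "z \<in> X"
    show "openin ?\<T> (W z)" using W z by blast
    have "continuous_map (subtopology ?\<T> (W z)) euclideanreal (\<lambda>y. \<Sum>n<N z. real n * \<phi> n y)"
      by (intro continuous_map_from_subtopology continuous_intros cont) auto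
    then show "continuous_map (subtopology ?\<T> (W z)) euclideanreal f"
      by (rule continuous_map_eq) (use W(3)[OF z] in auto)
  qed (use W(2) in \<open>auto simp: topspace_fuzzy_topology\<close>)
  moreover have "f (s n) = real n" for n
  proof -
    have "\<phi> k (s n) = 0" if "k \<noteq> n" for k using outside[OF sX e(3)[of n k]] that by simp
    then have "{k. \<phi> k (s n) \<noteq> 0} = {n}" using centre[of n] by auto
    then show ?thesis by (simp add: f_def centre)
  qed
  ultimately show ?thesis using that by blast
qed

text \<open>The counting function along the loop-erased subsequence has gaps of length at least one, so
  its image sequence fails to be pseudo-Cauchy.\<close>

lemma weak_G_complete_if_pseudo_Cauchy_images:
  assumes c: "\<And>f s. \<lbrakk>continuous_map (fuzzy_topology X M) euclideanreal f; G_Cauchy X M s\<rbrakk>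
    \<Longrightarrow> pseudo_Cauchy (f \<circ> s)"
  shows "weak_G_complete X M"
  unfolding weak_G_complete_def
proof (intro allI impI, rule ccontr)
  fix s assume s: "G_Cauchy X M s" and nc: "\<nexists>l. cluster_point (fuzzy_topology X M) s l"
  obtain h where h: "strict_mono h" "inj (s \<circ> h)" "G_Cauchy X M (s \<circ> h)"
    using G_Cauchy_inj_subsequence[OF s nc] by blast
  have "range (s \<circ> h) \<subseteq> X" using h(3) by (simp add: G_Cauchy_def)
  then obtain f where f: "continuous_map (fuzzy_topology X M) euclideanreal f"
      "\<And>n. f ((s \<circ> h) n) = real n"
    using continuous_map_counting_sequence[OF _ h(2) no_cluster_point_subseq[OF nc h(1)]] by blast
  have "pseudo_Cauchy (f \<circ> (s \<circ> h))" using c[OF f(1) h(3)] .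
  moreover have "(1/2::real) \<in> {0<..<1}" by simp
  ultimately obtain p q where pq: "p \<noteq> q" "dist ((f \<circ> (s \<circ> h)) p) ((f \<circ> (s \<circ> h)) q) < 1/2"
    unfolding pseudo_Cauchy_def by blast
  have "real_of_int \<bar>int p - int q\<bar> < 1/2" using pq(2) f(2) by (simp add: dist_of_nat)
  moreover have "\<bar>int p - int q\<bar> \<ge> 1" using pq(1) by linarith
  ultimately show False by linarith
qed

end

section \<open>Weak completeness through real-valued functions\<close>

theorem theorem3p1:
  fixes X :: "'a set" and M :: "'a \<Rightarrow> 'a \<Rightarrow> real \<Rightarrow> real" and T :: "real \<Rightarrow> real \<Rightarrow> real"
  assumes "fuzzy_metric_space X M T"
  shows "(weak_G_complete X M \<longleftrightarrow>
            (\<forall>f. continuous_map (fuzzy_topology X M) euclideanreal f \<longrightarrow>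
               (\<forall>s. G_Cauchy X M s \<longrightarrow> cofinally_Cauchy (f \<circ> s))))
       \<and> (weak_G_complete X M \<longleftrightarrow>
            (\<forall>f. continuous_map (fuzzy_topology X M) euclideanreal f \<longrightarrow>
               (\<forall>s. G_Cauchy X M s \<longrightarrow> pseudo_Cauchy (f \<circ> s))))"
  (is "(?a \<longleftrightarrow> ?b) \<and> (?a \<longleftrightarrow> ?c)")
proof -
  interpret fuzzy_metric_space X M T by (rule assms)
  have "?a \<Longrightarrow> ?b"
    unfolding weak_G_complete_def by (meson cluster_point_imp_cofinally_Cauchy)
  moreover have "?b \<Longrightarrow> ?c" by (meson cofinally_Cauchy_imp_pseudo_Cauchy)
  moreover have "?c \<Longrightarrow> ?a" by (rule weak_G_complete_if_pseudo_Cauchy_images) blast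
  ultimately show ?thesis by blast
qed

end
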